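(* Let $P$ be a probability distribution on $\mathbb N$ with finite mean and $P(1)<1$, and let $(Z_l)_{l\ge0}$ be the sequence of generations (point distributions on $\Omega=\mathbb Z_+\times\mathbb R_+$) of the multi-type branching process associated with the Erlang Weighted Tree, as in the context. Then for all $k\ge1$ and for every initial point distribution $\omega$ on $\Omega$, $$\mathbb P\left(\{0<Z_l(\Omega)\le k\ \text{ for infinitely many } l\}\mid Z_0=\omega\right)=0 .$$
   Context: $\mathbb N=\{1,2,\dots\}$, $\mathbb Z_+=\{0,1,\dots\}$, $\mathbb R_+=[0,\infty)$. A point distribution on $\Omega=\mathbb Z_+\times\mathbb R_+$ is a finite (possibly empty) collection of individuals, each with a type in $\Omega$ (finite multiset of types). Branching process: conditionally on generation $l$, individuals reproduce independently; an individual of type $(m,x)$ has $m$ potential children, and independently for each potential child one draws $K\sim P$, then $Z$ with Erlang density $e^{-z}z^{K-1}/(K-1)!$ given $K$, and an independent $U$ uniform on $[0,1]$; the potential child is an actual child (member of generation $l+1$) iff $xU<Z$, in which case its type is $(K-1,Z)$. $Z_l$ is the point distribution of types in generation $l$, started from $Z_0=\omega$, and $Z_l(\Omega)$ is the total number of individuals in generation $l$. (Starting from one individual of random type $(n_o,v_o)$ with $n_o\sim P$ and $v_o\mid n_o$ of density $e^{-x}x^{n_o}/n_o!$ gives the generations of the Erlang Weighted Tree with potential degree distribution $P$.) *)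

theory Defs
  imports "HOL-Probability.Probability"
begin

text \<open>
  Individuals carry a type \<open>(m, x)\<close>: the number \<open>m\<close> of potential children and a weight \<open>x\<close>.
  A point distribution is a finite multiset of types that lie in \<open>Omega\<close>.
\<close>

definition Omega :: "(nat \<times> real) set" where
  "Omega = UNIV \<times> {0..}"

text \<open>
  Each potential child carries a mark \<open>(K, z, U)\<close>. The joint density below (with respect to counting
  measure times Lebesgue measure on the plane) says that \<open>K\<close> has law \<open>P\<close>, that \<open>z\<close> has density
  \<open>exp (- z) * z ^ (K - 1) / fact (K - 1)\<close> on \<open>{0..}\<close> given \<open>K\<close> (the library's \<open>erlang_density n\<close>
  has shape parameter \<open>n + 1\<close>), and that \<open>U\<close> is uniform on \<open>{0..1}\<close> and independent of \<open>(K, z)\<close>.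
\<close>

type_synonym mark = "nat \<times> real \<times> real"

definition mark_space :: "mark measure" where
  "mark_space = count_space UNIV \<Otimes>\<^sub>M lborel \<Otimes>\<^sub>M lborel"

definition mark_density :: "nat pmf \<Rightarrow> mark \<Rightarrow> real" where
  "mark_density P = (\<lambda>(K, z, U). pmf P K * erlang_density (K - 1) 1 z * indicator {0..1} U)"

text \<open>
  (Potential) individuals are labelled by reversed Ulam-Harris words: \<open>[i]\<close> is the \<open>i\<close>-th individual
  of the initial generation, and \<open>j # u\<close> is the \<open>j\<close>-th potential child of \<open>u\<close>. The function
  \<open>ewt_type\<close> returns the type of an actual individual, and \<open>None\<close> for labels which do not belong to
  the process. Here \<open>ws\<close> lists the types of the initial individuals and \<open>X u\<close> is the mark of \<open>u\<close>;
  the marks of words of length at most one are not used.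
\<close>

fun ewt_type ::
  "(nat \<times> real) list \<Rightarrow> (nat list \<Rightarrow> mark) \<Rightarrow> nat list \<Rightarrow> (nat \<times> real) option" where
  "ewt_type ws X [] = None"
| "ewt_type ws X [i] = (if i < length ws then Some (ws ! i) else None)"
| "ewt_type ws X (j # i # u) =
     (case ewt_type ws X (i # u) of
        None \<Rightarrow> None
      | Some (m, x) \<Rightarrow>
          (case X (j # i # u) of (K, z, U) \<Rightarrow>
             if j < m \<and> x * U < z then Some (K - 1, z) else None))"

definition ewt_individuals ::
  "(nat \<times> real) list \<Rightarrow> (nat list \<Rightarrow> mark) \<Rightarrow> nat \<Rightarrow> nat list set" where
  "ewt_individuals ws X l = {u. length u = Suc l \<and> ewt_type ws X u \<noteq> None}"

text \<open>The image is taken as a multiset, so that individuals of equal type are counted separately.\<close>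

definition ewt_generation ::
  "(nat \<times> real) list \<Rightarrow> (nat list \<Rightarrow> mark) \<Rightarrow> nat \<Rightarrow> (nat \<times> real) multiset" where
  "ewt_generation ws X l =
     image_mset (\<lambda>u. the (ewt_type ws X u)) (mset_set (ewt_individuals ws X l))"

text \<open>
  \<open>Z\<close> is the sequence of generations, on the probability space \<open>M\<close>, of the branching process with
  potential degree distribution \<open>P\<close> started from the point distribution \<open>\<omega>\<close>. All marks are
  independent; since the generations up to \<open>l\<close> only involve marks of words of length at most
  \<open>l + 1\<close>, the individuals of generation \<open>l\<close> reproduce independently of each other and of the past.
\<close>

definition ewt_branching_process ::
  "'a measure \<Rightarrow> nat pmf \<Rightarrow> (nat \<times> real) multiset \<Rightarrow> (nat \<Rightarrow> 'a \<Rightarrow> (nat \<times> real) multiset) \<Rightarrow> bool" where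
  "ewt_branching_process M P \<omega> Z \<longleftrightarrow>
     prob_space M \<and>
     (\<exists>ws X. mset ws = \<omega> \<and>
        prob_space.indep_vars M (\<lambda>_. mark_space) X UNIV \<and>
        (\<forall>u. distributed M mark_space (X u) (\<lambda>y. ennreal (mark_density P y))) \<and>
        (\<forall>l. \<forall>w\<in>space M. Z l w = ewt_generation ws (\<lambda>u. X u w) l))"

text \<open>Sanity checks: every generation is finite (on infinite sets, \<open>mset_set\<close> would be empty), the
  initial generation is \<open>\<omega>\<close>, and an individual's actual children are those of its potential
  children \<open>j < m\<close> with \<open>x * U < z\<close>.\<close>

lemma ewt_individuals_0: "ewt_individuals ws X 0 = (\<lambda>i. [i]) ` {..<length ws}"
  by (auto simp: ewt_individuals_def length_Suc_conv split: if_splits)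

lemma ewt_individuals_Suc:
  "ewt_individuals ws X (Suc l) =
     (\<Union>u\<in>ewt_individuals ws X l. case the (ewt_type ws X u) of (m, x) \<Rightarrow>
        (\<lambda>j. j # u) ` {j. j < m \<and> (case X (j # u) of (K, z, U) \<Rightarrow> x * U < z)})"
  by (fastforce simp: ewt_individuals_def length_Suc_conv split: option.splits prod.splits if_splits)

lemma finite_ewt_individuals: "finite (ewt_individuals ws X l)"
  by (induction l) (auto simp: ewt_individuals_0 ewt_individuals_Suc split: prod.splits)

lemma ewt_generation_0: "ewt_generation ws X 0 = mset ws"
proof -
  have "mset_set ((\<lambda>i. [i]) ` {..<length ws}) = image_mset (\<lambda>i. [i]) (mset_set {..<length ws})"
    by (rule image_mset_mset_set[symmetric]) (auto simp: inj_on_def)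
  then have "ewt_generation ws X 0 =
      image_mset (\<lambda>i. the (ewt_type ws X [i])) (mset_set {..<length ws})"
    by (simp add: ewt_generation_def ewt_individuals_0 multiset.map_comp comp_def)
  also have "\<dots> = image_mset (\<lambda>i. ws ! i) (mset_set {..<length ws})"
    by (intro image_mset_cong) auto
  also have "\<dots> = mset (map (\<lambda>i. ws ! i) [0..<length ws])"
    by (simp add: lessThan_atLeast0)
  finally show ?thesis
    by (simp only: map_nth)
qed

end

theory Submission
  imports Defs
begin

text \<open>
  Whatever the parent's weight \<open>x\<close>, an actual child has, with probability bounded below uniformly in
  \<open>x\<close>, a fixed number of potential children and weight at least \<open>1\<close>: a fresh mark satisfies this and
  \<open>x * U < z\<close> with probability at least a constant times \<open>1 / max 1 x\<close>, while by Markov's inequality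
  and the finite mean of \<open>P\<close> it satisfies \<open>x * U < z\<close> with probability at most a constant times
  \<open>1 / max 1 x\<close>. Such a child has no children of its own with a probability bounded below. Hence there
  is \<open>d > 0\<close> with \<open>P(0 < N(l+1) \<le> k, N(l+2) = 0) \<ge> d * P(0 < N(l+1) \<le> k)\<close> for all \<open>l\<close>, where \<open>N(l)\<close>
  is the size of generation \<open>l\<close>. The events on the left are disjoint for different \<open>l\<close>, so the
  probabilities on the right are summable, and the Borel-Cantelli lemma applies.
\<close>

section \<open>The law of a single mark\<close>

definition mark_distr :: "nat pmf \<Rightarrow> mark measure" where
  "mark_distr P = density mark_space (\<lambda>y. ennreal (mark_density P y))"

lemma space_mark_space [simp]: "space mark_space = UNIV"
  by (simp add: mark_space_def space_pair_measure)

lemma sets_mark_distr [simp, measurable_cong]: "sets (mark_distr P) = sets mark_space"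
  by (simp add: mark_distr_def)

lemma space_mark_distr [simp]: "space (mark_distr P) = UNIV"
  by (simp add: mark_distr_def)

lemma measurable_mark_fst [measurable]: "fst \<in> measurable mark_space (count_space UNIV)"
  by (simp add: mark_space_def)

lemma measurable_mark_weight [measurable]: "(\<lambda>y. fst (snd y)) \<in> borel_measurable mark_space"
  by (simp add: mark_space_def)

lemma measurable_mark_uniform [measurable]: "(\<lambda>y. snd (snd y)) \<in> borel_measurable mark_space"
  by (simp add: mark_space_def)

lemma measurable_mark_density [measurable]: "mark_density P \<in> borel_measurable mark_space"
proof -
  have [measurable]: "(\<lambda>y::mark. erlang_density (fst y - 1) 1 (fst (snd y))) \<in> borel_measurable mark_space"
    by (rule measurable_compose_countable[where g = fst and f = "\<lambda>K y. erlang_density (K - 1) 1 (fst (snd y))"])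
       measurable
  have "mark_density P = (\<lambda>y. pmf P (fst y) * erlang_density (fst y - 1) 1 (fst (snd y)) *
      indicator {0..1} (snd (snd y)))"
    by (auto simp: mark_density_def)
  then show ?thesis
    by simp
qed

lemma sets_actual [measurable]: "{y. x * snd (snd y) < fst (snd y)} \<in> sets mark_space"
proof -
  have "{y \<in> space mark_space. x * snd (snd y) < fst (snd y)} \<in> sets mark_space"
    by measurable
  then show ?thesis
    by simp
qed

lemma sets_mark_box [measurable]: "{K} \<times> {a..b} \<times> {c..d} \<in> sets mark_space"
  unfolding mark_space_def by (intro pair_measureI) auto

text \<open>For weights in \<open>{a..b}\<close> one has
  \<open>z ^ (K - 1) \<ge> a ^ (K - 1)\<close> and \<open>exp (- z) \<ge> exp (- b)\<close>, so the
  density is bounded below by a constant on the box, whose measure is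
  \<open>(b - a) * (d - c)\<close>.\<close>

lemma emeasure_mark_distr_box_ge:
  assumes "0 \<le> a" "a \<le> b" "0 \<le> c" "c \<le> d" "d \<le> 1"
  shows "ennreal (pmf P K * (a ^ (K - 1) * exp (- b) / fact (K - 1)) * ((b - a) * (d - c)))
    \<le> emeasure (mark_distr P) ({K} \<times> {a..b} \<times> {c..d})"
proof -
  let ?B = "{K} \<times> {a..b} \<times> {c..d}"
  let ?e = "pmf P K * (a ^ (K - 1) * exp (- b) / fact (K - 1))"
  have L: "sigma_finite_measure (lborel \<Otimes>\<^sub>M lborel :: (real \<times> real) measure)"
    unfolding lborel_prod by (rule sigma_finite_lborel)
  have e: "0 \<le> ?e"
    using assms by simp
  have "emeasure mark_space ?B = emeasure (count_space UNIV) {K} *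
      (emeasure lborel {a..b} * emeasure lborel {c..d})"
    unfolding mark_space_def
    by (subst sigma_finite_measure.emeasure_pair_measure_Times[OF L]) (auto intro!: pair_measureI simp: lborel.emeasure_pair_measure_Times)
  also have "\<dots> = ennreal ((b - a) * (d - c))"
    using assms by (simp add: ennreal_mult)
  finally have B: "emeasure mark_space ?B = ennreal ((b - a) * (d - c))" .
  have le: "?e \<le> mark_density P y" if "y \<in> ?B" for y
    using that assms
    by (auto simp: mark_density_def erlang_density_def intro!: mult_left_mono divide_right_mono mult_mono power_mono)
  have "ennreal (?e * ((b - a) * (d - c))) = (\<integral>\<^sup>+y. ennreal ?e * indicator ?B y \<partial>mark_space)"
    using e by (subst ennreal_mult'[OF e]) (simp only: nn_integral_cmult_indicator[OF sets_mark_box] B)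
  also have "\<dots> \<le> (\<integral>\<^sup>+y. ennreal (mark_density P y) * indicator ?B y \<partial>mark_space)"
    using le by (intro nn_integral_mono) (auto intro!: ennreal_leI split: split_indicator)
  also have "\<dots> = emeasure (mark_distr P) ?B"
    by (simp add: mark_distr_def emeasure_density)
  finally show ?thesis .
qed

text \<open>Tonelli's theorem, with \<open>U\<close> innermost so that \<open>K\<close> and
  \<open>z\<close> are constants when a condition such as \<open>x * U < z\<close> is integrated
  out.\<close>

lemma emeasure_mark_distr:
  assumes [measurable]: "A \<in> sets mark_space"
  shows "emeasure (mark_distr P) A =
    (\<integral>\<^sup>+K. \<integral>\<^sup>+z. \<integral>\<^sup>+U. ennreal (mark_density P (K, z, U)) * indicator A (K, z, U)
      \<partial>lborel \<partial>lborel \<partial>count_space UNIV)"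
proof -
  have L: "sigma_finite_measure (lborel \<Otimes>\<^sub>M lborel :: (real \<times> real) measure)"
    unfolding lborel_prod by (rule sigma_finite_lborel)
  let ?f = "\<lambda>y. ennreal (mark_density P y) * indicator A y"
  have f: "?f \<in> borel_measurable (count_space UNIV \<Otimes>\<^sub>M (lborel \<Otimes>\<^sub>M lborel))"
    unfolding mark_space_def[symmetric] by measurable
  have g: "(\<lambda>p. ?f (K, p)) \<in> borel_measurable (lborel \<Otimes>\<^sub>M lborel)" for K
    by (rule measurable_compose[OF _ f]) simp
  have "emeasure (mark_distr P) A = integral\<^sup>N (count_space UNIV \<Otimes>\<^sub>M (lborel \<Otimes>\<^sub>M lborel)) ?f"
    by (simp add: mark_distr_def emeasure_density mark_space_def[symmetric])
  also have "\<dots> = (\<integral>\<^sup>+K. \<integral>\<^sup>+p. ?f (K, p) \<partial>(lborel \<Otimes>\<^sub>M lborel) \<partial>count_space UNIV)"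
    by (rule sigma_finite_measure.nn_integral_fst[OF L f, symmetric])
  also have "\<dots> = (\<integral>\<^sup>+K. \<integral>\<^sup>+z. \<integral>\<^sup>+U. ?f (K, z, U) \<partial>lborel \<partial>lborel \<partial>count_space UNIV)"
    by (intro nn_integral_cong lborel.nn_integral_fst[OF g, symmetric])
  finally show ?thesis .
qed

text \<open>A potential child of weight \<open>z \<ge> 0\<close> is actual with probability \<open>min 1 (z / x) \<le> z / x\<close>.\<close>

lemma emeasure_actual_le:
  assumes "0 < x" and int: "integrable (measure_pmf P) real"
  shows "emeasure (mark_distr P) {y. x * snd (snd y) < fst (snd y)}
    \<le> ennreal ((measure_pmf.expectation P real + 1) / x)"
proof -
  let ?A = "{y::mark. x * snd (snd y) < fst (snd y)}"
  have "emeasure (mark_distr P) ?A \<le>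
      (\<integral>\<^sup>+K. \<integral>\<^sup>+z. ennreal (pmf P K) * ennreal (erlang_density (K - 1) 1 z * z ^ 1) * ennreal (1 / x)
        \<partial>lborel \<partial>count_space UNIV)"
    unfolding emeasure_mark_distr[OF sets_actual]
  proof (intro nn_integral_mono)
    fix K :: nat and z :: real
    let ?e = "pmf P K * erlang_density (K - 1) 1 z"
    have "(\<integral>\<^sup>+U. ennreal (mark_density P (K, z, U)) * indicator ?A (K, z, U) \<partial>lborel)
        \<le> (\<integral>\<^sup>+U. ennreal ?e * indicator {0..\<bar>z\<bar> / x} U \<partial>lborel)"
    proof (intro nn_integral_mono)
      fix U :: real
      have "x * U < z \<Longrightarrow> U \<le> \<bar>z\<bar> / x"
        using \<open>0 < x\<close> by (simp add: field_simps)
      then show "ennreal (mark_density P (K, z, U)) * indicator ?A (K, z, U)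
          \<le> ennreal ?e * indicator {0..\<bar>z\<bar> / x} U"
        by (auto simp: mark_density_def split: split_indicator)
    qed
    also have "\<dots> = ennreal (?e * (\<bar>z\<bar> / x))"
      using \<open>0 < x\<close> by (subst ennreal_mult') (simp_all add: nn_integral_cmult_indicator)
    also have "?e * (\<bar>z\<bar> / x) = pmf P K * (erlang_density (K - 1) 1 z * z ^ 1) * (1 / x)"
      by (auto simp: erlang_density_def)
    also have "ennreal \<dots> = ennreal (pmf P K) * ennreal (erlang_density (K - 1) 1 z * z ^ 1) * ennreal (1 / x)"
      using \<open>0 < x\<close> by (subst ennreal_mult'', simp, subst ennreal_mult', simp_all)
    finally show "(\<integral>\<^sup>+U. ennreal (mark_density P (K, z, U)) * indicator ?A (K, z, U) \<partial>lborel) \<le> \<dots>" .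
  qed
  \<comment> \<open>The integral over \<open>z\<close> is the mean of the Erlang law, equal to its
    shape parameter \<open>Suc (K - 1)\<close>. With truncated subtraction this is at most
    \<open>K + 1\<close> for every natural \<open>K\<close>.\<close>
  also have "\<dots> = (\<integral>\<^sup>+K. ennreal (pmf P K) * ennreal (real (Suc (K - 1))) * ennreal (1 / x) \<partial>count_space UNIV)"
  proof (intro nn_integral_cong)
    fix K :: nat
    have "(\<integral>\<^sup>+z. ennreal (erlang_density (K - 1) 1 z * z ^ 1) \<partial>lborel) = ennreal (real (Suc (K - 1)))"
      by (subst nn_integral_erlang_ith_moment) (simp_all del: of_nat_Suc)
    then show "(\<integral>\<^sup>+z. ennreal (pmf P K) * ennreal (erlang_density (K - 1) 1 z * z ^ 1) * ennreal (1 / x) \<partial>lborel)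
        = ennreal (pmf P K) * ennreal (real (Suc (K - 1))) * ennreal (1 / x)"
      by (subst nn_integral_multc, simp, subst nn_integral_cmult) auto
  qed
  also have "\<dots> = (\<integral>\<^sup>+K. ennreal (real (Suc (K - 1)) / x) \<partial>measure_pmf P)"
    unfolding nn_integral_measure_pmf using \<open>0 < x\<close>
    by (intro nn_integral_cong) (subst mult.assoc, subst ennreal_mult[symmetric], simp_all)
  also have "\<dots> \<le> (\<integral>\<^sup>+K. ennreal ((real K + 1) / x) \<partial>measure_pmf P)"
    using \<open>0 < x\<close> by (intro nn_integral_mono ennreal_leI divide_right_mono) auto
  also have "\<dots> = ennreal (measure_pmf.expectation P (\<lambda>K. (real K + 1) / x))"
    using \<open>0 < x\<close> int by (intro nn_integral_eq_integral) auto
  also have "measure_pmf.expectation P (\<lambda>K. (real K + 1) / x) = (measure_pmf.expectation P real + 1) / x"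
    using int by simp
  finally show ?thesis .
qed

section \<open>Independent marks and resampling of single coordinates\<close>

locale ewt_marks = prob_space M for M :: "'a measure" +
  fixes P :: "nat pmf" and X :: "nat list \<Rightarrow> 'a \<Rightarrow> mark"
  assumes indep_marks: "indep_vars (\<lambda>_. mark_space) X UNIV"
    and distributed_mark: "distributed M mark_space (X u) (\<lambda>y. ennreal (mark_density P y))"
begin

lemma measurable_mark [measurable]: "X u \<in> measurable M mark_space"
  using distributed_mark by (simp add: distributed_def)

lemma distr_mark: "distr M mark_space (X u) = mark_distr P"
  using distributed_mark by (simp add: distributed_def mark_distr_def)

lemma prob_space_mark_distr: "prob_space (mark_distr P)"
  using prob_space_distr[OF measurable_mark] by (simp add: distr_mark)

lemma measurable_marks [measurable]: "(\<lambda>w u. X u w) \<in> measurable M (PiM UNIV (\<lambda>_. mark_space))"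
  by (rule measurable_PiM_single') auto

text \<open>The mark of \<open>v\<close> is independent of all other marks, so their joint law is a
  product. By Tonelli, the probability of an event is the mean, over the other marks, of its
  probability under a fresh mark at \<open>v\<close>.\<close>

lemma
  assumes Q: "Measurable.pred (PiM UNIV (\<lambda>_. mark_space)) Q"
  shows borel_measurable_resample:
      "(\<lambda>w. emeasure (mark_distr P) {m. Q ((\<lambda>u. X u w)(v := m))}) \<in> borel_measurable M" (is ?meas)
    and emeasure_resample: "emeasure M {w \<in> space M. Q (\<lambda>u. X u w)} =
      (\<integral>\<^sup>+w. emeasure (mark_distr P) {m. Q ((\<lambda>u. X u w)(v := m))} \<partial>M)" (is ?eq)
proof -
  let ?N = "PiM (- {v}) (\<lambda>_. mark_space)" and ?L = "PiM {v} (\<lambda>_. mark_space)"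
  let ?Y = "\<lambda>w. restrict (\<lambda>u. X u w) (- {v})" and ?W = "\<lambda>w. restrict (\<lambda>u. X u w) {v}"
  have Y [measurable]: "?Y \<in> measurable M ?N" and W [measurable]: "?W \<in> measurable M ?L"
    by (rule measurable_restrict, simp)+
  interpret W: prob_space "distr M ?L ?W"
    by (rule prob_space_distr[OF W])
  have "indep_var ?N ?Y ?L ?W"
    by (rule indep_var_restrict[OF indep_marks]) auto
  then have joint: "distr M (?N \<Otimes>\<^sub>M ?L) (\<lambda>w. (?Y w, ?W w)) = distr M ?N ?Y \<Otimes>\<^sub>M distr M ?L ?W"
    by (simp add: indep_var_distribution_eq)
  have upd: "(\<lambda>p. (fst p)(v := snd p v)) \<in> measurable (?N \<Otimes>\<^sub>M ?L) (PiM UNIV (\<lambda>_. mark_space))"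
    by (rule measurable_fun_upd[where J = "- {v}"]) auto
  define A where "A = {p \<in> space (?N \<Otimes>\<^sub>M ?L). Q ((fst p)(v := snd p v))}"
  have "(\<lambda>p. Q ((fst p)(v := snd p v))) \<in> measurable (?N \<Otimes>\<^sub>M ?L) (count_space UNIV)"
    by (rule measurable_compose[OF upd Q])
  then have A [measurable]: "A \<in> sets (?N \<Otimes>\<^sub>M ?L)"
    unfolding A_def by (simp add: pred_def)
  have mem: "(?Y w, ?W w') \<in> A \<longleftrightarrow> Q ((\<lambda>u. X u w)(v := X v w'))"
    if "w \<in> space M" "w' \<in> space M" for w w'
  proof -
    have "(?Y w)(v := ?W w' v) = (\<lambda>u. X u w)(v := X v w')"
      by auto
    then show ?thesis
      using measurable_space[OF Y that(1)] measurable_space[OF W that(2)]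
      by (simp add: A_def space_pair_measure)
  qed
  have sec: "emeasure (distr M ?L ?W) (Pair (?Y w) -` A) =
      emeasure (mark_distr P) {m. Q ((\<lambda>u. X u w)(v := m))}" if w: "w \<in> space M" for w
  proof -
    have "(\<lambda>m. (\<lambda>u. X u w)(v := m)) \<in> measurable mark_space (PiM UNIV (\<lambda>_. mark_space))"
      by (rule measurable_PiM_single') auto
    from measurable_compose[OF this Q] have "{m. Q ((\<lambda>u. X u w)(v := m))} \<in> sets mark_space"
      by (simp add: pred_def)
    then have "emeasure (mark_distr P) {m. Q ((\<lambda>u. X u w)(v := m))} =
        emeasure M ({w'. Q ((\<lambda>u. X u w)(v := X v w'))} \<inter> space M)"
      unfolding distr_mark[of v, symmetric] by (simp add: emeasure_distr vimage_def)
    also have "{w'. Q ((\<lambda>u. X u w)(v := X v w'))} \<inter> space M = ?W -` (Pair (?Y w) -` A) \<inter> space M"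
      using mem[OF w] by auto
    also have "emeasure M \<dots> = emeasure (distr M ?L ?W) (Pair (?Y w) -` A)"
      by (rule emeasure_distr[symmetric]) (auto intro: sets_Pair1)
    finally show ?thesis ..
  qed
  have sec_meas: "(\<lambda>y. emeasure (distr M ?L ?W) (Pair y -` A)) \<in> borel_measurable ?N"
    by (rule W.measurable_emeasure_Pair) simp
  have "(\<lambda>w. emeasure (distr M ?L ?W) (Pair (?Y w) -` A)) \<in> borel_measurable M"
    by (rule measurable_compose[OF Y sec_meas])
  then show ?meas
    by (simp add: sec cong: measurable_cong)
  \<comment> \<open>On the diagonal, \<open>mem\<close> updates the mark of \<open>v\<close> by its
    own value, which changes nothing.\<close>
  have "{w \<in> space M. Q (\<lambda>u. X u w)} = (\<lambda>w. (?Y w, ?W w)) -` A \<inter> space M"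
    using mem by (auto simp: fun_upd_idem)
  then have "emeasure M {w \<in> space M. Q (\<lambda>u. X u w)} =
      emeasure (distr M (?N \<Otimes>\<^sub>M ?L) (\<lambda>w. (?Y w, ?W w))) A"
    by (simp add: emeasure_distr)
  also have "\<dots> = (\<integral>\<^sup>+y. emeasure (distr M ?L ?W) (Pair y -` A) \<partial>distr M ?N ?Y)"
    unfolding joint by (rule W.emeasure_pair_measure_alt) simp
  also have "\<dots> = (\<integral>\<^sup>+w. emeasure (distr M ?L ?W) (Pair (?Y w) -` A) \<partial>M)"
    by (rule nn_integral_distr[OF Y]) (use sec_meas in simp)
  also have "\<dots> = (\<integral>\<^sup>+w. emeasure (mark_distr P) {m. Q ((\<lambda>u. X u w)(v := m))} \<partial>M)"
    by (rule nn_integral_cong) (rule sec)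
  finally show ?eq .
qed

text \<open>The conditions \<open>C v\<close> are imposed one coordinate at a time, each keeping at least a fraction \<open>r\<close>.\<close>

lemma emeasure_resample_finite:
  assumes "finite F" and Q [measurable]: "Measurable.pred (PiM UNIV (\<lambda>_. mark_space)) Q"
    and C: "\<And>v. v \<in> F \<Longrightarrow> C v \<in> sets mark_space"
    and le: "\<And>v x. v \<in> F \<Longrightarrow> r * emeasure (mark_distr P) {m. Q (x(v := m))}
      \<le> emeasure (mark_distr P) {m. Q (x(v := m)) \<and> m \<in> C v}"
  shows "r ^ card F * emeasure M {w \<in> space M. Q (\<lambda>u. X u w)}
    \<le> emeasure M {w \<in> space M. Q (\<lambda>u. X u w) \<and> (\<forall>v\<in>F. X v w \<in> C v)}"
  using assms(1) C le
proof (induction F)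
  case empty
  then show ?case by simp
next
  case (insert v F)
  let ?Q = "\<lambda>F x. Q x \<and> (\<forall>u\<in>F. x u \<in> C u)"
  have Q' [measurable]: "Measurable.pred (PiM UNIV (\<lambda>_. mark_space)) (?Q G)" if "G \<subseteq> insert v F" for G
  proof -
    have "finite G"
      using that insert.hyps(1) by (auto intro: finite_subset)
    moreover have "Measurable.pred (PiM UNIV (\<lambda>_. mark_space)) (\<lambda>x. x u \<in> C u)" if "u \<in> G" for u
      using insert.prems(1)[of u] that \<open>G \<subseteq> insert v F\<close>
      by (intro pred_sets2[OF _ measurable_component_singleton]) auto
    ultimately show ?thesis
      by (intro pred_intros_logic Q pred_intros_finite)
  qed
  have "r ^ card (insert v F) * emeasure M {w \<in> space M. Q (\<lambda>u. X u w)} =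
      r * (r ^ card F * emeasure M {w \<in> space M. Q (\<lambda>u. X u w)})"
    using insert.hyps by (simp add: mult.assoc)
  also have "\<dots> \<le> r * emeasure M {w \<in> space M. ?Q F (\<lambda>u. X u w)}"
    using insert.prems by (intro mult_left_mono insert.IH) auto
  also have "\<dots> = r * (\<integral>\<^sup>+w. emeasure (mark_distr P) {m. ?Q F ((\<lambda>u. X u w)(v := m))} \<partial>M)"
    by (subst emeasure_resample[OF Q']) auto
  also have "\<dots> = (\<integral>\<^sup>+w. r * emeasure (mark_distr P) {m. ?Q F ((\<lambda>u. X u w)(v := m))} \<partial>M)"
    by (rule nn_integral_cmult[symmetric], rule borel_measurable_resample[OF Q']) auto
  \<comment> \<open>The conditions on \<open>F\<close> do not involve coordinate \<open>v\<close>.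
    With the other marks frozen, either they all hold and the hypothesis for \<open>v\<close>
    applies, or the left side is zero.\<close>
  also have "\<dots> \<le> (\<integral>\<^sup>+w. emeasure (mark_distr P) {m. ?Q (insert v F) ((\<lambda>u. X u w)(v := m))} \<partial>M)"
  proof (rule nn_integral_mono)
    fix w
    let ?x = "\<lambda>u. X u w"
    have upd: "(?x(v := m)) u = ?x u" if "u \<in> F" for u m
      using insert.hyps(2) that by auto
    show "r * emeasure (mark_distr P) {m. ?Q F (?x(v := m))}
        \<le> emeasure (mark_distr P) {m. ?Q (insert v F) (?x(v := m))}"
    proof (cases "\<forall>u\<in>F. ?x u \<in> C u")
      case True
      then have "{m. ?Q F (?x(v := m))} = {m. Q (?x(v := m))}"
        "{m. ?Q (insert v F) (?x(v := m))} = {m. Q (?x(v := m)) \<and> m \<in> C v}"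
        using upd by auto
      then show ?thesis
        using insert.prems(2)[of v ?x] by (simp only: insertI1)
    next
      case False
      then have "{m. ?Q F (?x(v := m))} = {}"
        using upd by force
      then show ?thesis
        by (simp only: emeasure_empty mult_zero_right zero_le)
    qed
  qed
  also have "\<dots> = emeasure M {w \<in> space M. ?Q (insert v F) (\<lambda>u. X u w)}"
    by (subst emeasure_resample[OF Q', symmetric]) auto
  finally show ?case .
qed

text \<open>Both probabilities are compared with \<open>t = 1 / max 1 x\<close>: the first is at
  most \<open>d * t\<close>, and the second is at least \<open>e * (t / 2)\<close> because of a box
  inside the event. The quotient \<open>e / (2 * d)\<close> of the bounds is free of
  \<open>x\<close>.\<close>

lemma emeasure_actual_retained_ge:
  assumes int: "integrable (measure_pmf P) real" and K: "K \<in> set_pmf P"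
  obtains r where "0 < r" and
    "\<And>x. ennreal r * emeasure (mark_distr P) {y. x * snd (snd y) < fst (snd y)}
      \<le> emeasure (mark_distr P) {y. x * snd (snd y) < fst (snd y) \<and> y \<in> {K} \<times> {1..} \<times> UNIV}"
proof
  interpret D: prob_space "mark_distr P"
    by (rule prob_space_mark_distr)
  define d where "d = measure_pmf.expectation P real + 1"
  define e where "e = pmf P K * (1 ^ (K - 1) * exp (- 2) / fact (K - 1))"
  have d: "1 \<le> d"
    by (simp add: d_def)
  have e: "0 < e"
    using K by (simp add: e_def pmf_positive)
  show "0 < e / (2 * d)"
    using d e by simp
  fix x :: real
  let ?A = "{y::mark. x * snd (snd y) < fst (snd y)}"
  let ?B = "{y::mark. x * snd (snd y) < fst (snd y) \<and> y \<in> {K} \<times> {1..} \<times> UNIV}"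
  define t where "t = 1 / max 1 x"
  have t: "0 < t" "t \<le> 1"
    by (auto simp: t_def field_simps max_def)
  \<comment> \<open>For \<open>x \<le> 1\<close> the trivial bound \<open>1\<close> suffices, as
    \<open>t = 1\<close> and \<open>d \<ge> 1\<close>; the moment bound is used for
    \<open>x > 1\<close>.\<close>
  have le: "emeasure (mark_distr P) ?A \<le> ennreal (d * t)"
  proof (cases "x \<le> 1")
    case True
    have "emeasure (mark_distr P) ?A \<le> ennreal 1"
      using D.emeasure_le_1 by simp
    also have "\<dots> \<le> ennreal (d * t)"
      using True d by (intro ennreal_leI) (simp add: t_def)
    finally show ?thesis .
  next
    case False
    then show ?thesis
      using emeasure_actual_le[OF _ int, of x] by (simp add: t_def d_def)
  qed
  \<comment> \<open>For nonnegative \<open>x\<close>, \<open>U \<le> t / 2\<close> gives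
    \<open>x * U \<le> 1 / 2\<close>, which is below every weight in \<open>{1..2}\<close>.\<close>
  have "{K} \<times> {1..2} \<times> {0..t / 2} \<subseteq> ?B"
  proof -
    have "x * U < 1" if "0 \<le> U" "U \<le> t / 2" for U
    proof (cases "0 \<le> x")
      case True
      then have "x * U \<le> max 1 x * (t / 2)"
        using that by (intro mult_mono) auto
      then show ?thesis
        by (simp add: t_def)
    next
      case False
      then have "x * U \<le> 0"
        using that by (intro mult_nonpos_nonneg) auto
      then show ?thesis
        by simp
    qed
    then show ?thesis
      by fastforce
  qed
  moreover have "?B \<in> sets mark_space"
  proof -
    have "{y \<in> space mark_space. x * snd (snd y) < fst (snd y) \<and> fst y = K \<and> 1 \<le> fst (snd y)} \<in> sets mark_space"
      by measurable
    moreover have "?B = {y \<in> space mark_space. x * snd (snd y) < fst (snd y) \<and> fst y = K \<and> 1 \<le> fst (snd y)}"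
      by auto
    ultimately show ?thesis
      by simp
  qed
  ultimately have "emeasure (mark_distr P) ({K} \<times> {1..2} \<times> {0..t / 2}) \<le> emeasure (mark_distr P) ?B"
    by (intro emeasure_mono) simp_all
  moreover have "ennreal (e * (t / 2)) \<le> emeasure (mark_distr P) ({K} \<times> {1..2} \<times> {0..t / 2})"
    using emeasure_mark_distr_box_ge[of 1 2 0 "t / 2" P K] t by (simp add: e_def)
  moreover have "ennreal (e / (2 * d)) * emeasure (mark_distr P) ?A \<le> ennreal (e / (2 * d)) * ennreal (d * t)"
    by (intro mult_left_mono le) simp
  moreover have "ennreal (e / (2 * d)) * ennreal (d * t) = ennreal (e * (t / 2))"
    using d e t by (subst ennreal_mult[symmetric]) auto
  ultimately show "ennreal (e / (2 * d)) * emeasure (mark_distr P) ?A \<le> emeasure (mark_distr P) ?B"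
    by order
qed

text \<open>If \<open>z \<le> U\<close> and the parent's weight \<open>x\<close> is at least
  \<open>1\<close>, then \<open>z \<le> x * U\<close> and the potential child is not actual. Marks
  of this kind have positive probability because they contain a box below the diagonal.\<close>

lemma emeasure_childless_pos:
  "0 < emeasure (mark_distr P) {y. 0 \<le> snd (snd y) \<and> fst (snd y) \<le> snd (snd y)}" (is "0 < emeasure _ ?D")
proof -
  obtain K where K: "K \<in> set_pmf P"
    using set_pmf_not_empty[of P] by auto
  have "{y \<in> space mark_space. 0 \<le> snd (snd y) \<and> fst (snd y) \<le> snd (snd y)} \<in> sets mark_space"
    by measurable
  then have D: "?D \<in> sets mark_space"
    by simp
  \<comment> \<open>The weights start at \<open>1 / 4\<close> rather than \<open>0\<close> so that
    the factor \<open>a ^ (K - 1)\<close> in the box bound stays positive.\<close>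
  have "0 < ennreal (pmf P K * ((1 / 4) ^ (K - 1) * exp (- (1 / 2)) / fact (K - 1)) * ((1 / 2 - 1 / 4) * (1 - 1 / 2)))"
    using K by (simp add: pmf_positive)
  also have "\<dots> \<le> emeasure (mark_distr P) ({K} \<times> {1 / 4..1 / 2} \<times> {1 / 2..1})"
    by (rule emeasure_mark_distr_box_ge) auto
  also have "\<dots> \<le> emeasure (mark_distr P) ?D"
    using D by (intro emeasure_mono) auto
  finally show ?thesis .
qed

end

section \<open>How the generations depend on the marks\<close>

lemma ewt_type_cong:
  assumes "X u = X' u" "\<And>u'. length u' < length u \<Longrightarrow> X u' = X' u'"
  shows "ewt_type ws X u = ewt_type ws X' u"
  using assms
proof (induction u rule: induct_list012)
  case (3 j i u)
  have "ewt_type ws X (i # u) = ewt_type ws X' (i # u)"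
    by (rule 3(2)) (auto intro: 3(4))
  then show ?case
    by (simp only: ewt_type.simps 3(3))
qed auto

text \<open>The type that a label has if it is actual; unlike \<^const>\<open>ewt_type\<close>, it depends on the label's own
  mark only.\<close>

fun ewt_label_type :: "(nat \<times> real) list \<Rightarrow> (nat list \<Rightarrow> mark) \<Rightarrow> nat list \<Rightarrow> nat \<times> real" where
  "ewt_label_type ws X [i] = ws ! i"
| "ewt_label_type ws X u = (fst (X u) - 1, fst (snd (X u)))"

lemma the_ewt_type: "ewt_type ws X u \<noteq> None \<Longrightarrow> the (ewt_type ws X u) = ewt_label_type ws X u"
  by (induction u rule: induct_list012) (auto split: option.splits prod.splits if_splits)

text \<open>Separates the parent being actual from the condition on the label's own mark. This form
  gives measurability by induction and lets one mark vary alone.\<close>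

lemma ewt_type_Cons_ne_None:
  "ewt_type ws X (j # i # u) \<noteq> None \<longleftrightarrow> ewt_type ws X (i # u) \<noteq> None \<and>
    j < fst (ewt_label_type ws X (i # u)) \<and>
    snd (ewt_label_type ws X (i # u)) * snd (snd (X (j # i # u))) < fst (snd (X (j # i # u)))"
  using the_ewt_type[of ws X "i # u"]
  by (cases "ewt_label_type ws X (i # u)") (auto split: option.splits prod.splits)

lemma measurable_ewt_label_type [measurable]:
  "(\<lambda>X. fst (ewt_label_type ws X u)) \<in> measurable (PiM UNIV (\<lambda>_. mark_space)) (count_space UNIV)"
  "(\<lambda>X. snd (ewt_label_type ws X u)) \<in> borel_measurable (PiM UNIV (\<lambda>_. mark_space))"
  by (cases "(ws, \<lambda>_::nat list. undefined :: mark, u)" rule: ewt_label_type.cases; simp)+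

lemma measurable_ewt_type_ne_None [measurable]:
  "Measurable.pred (PiM UNIV (\<lambda>_. mark_space)) (\<lambda>X. ewt_type ws X u \<noteq> None)"
proof (induction u rule: induct_list012)
  case (3 j i u)
  then show ?case
    unfolding ewt_type_Cons_ne_None by measurable
qed (auto simp: if_distrib)

lemma measurable_ewt_individuals_eq [measurable]:
  "Measurable.pred (PiM UNIV (\<lambda>_. mark_space)) (\<lambda>X. ewt_individuals ws X l = S)"
proof -
  have "ewt_individuals ws X l = S \<longleftrightarrow>
      (\<forall>u. (length u = Suc l \<and> ewt_type ws X u \<noteq> None) = (u \<in> S))" for X
    by (auto simp: ewt_individuals_def)
  then show ?thesis
    by (simp only:) measurable
qed

lemma ewt_individuals_upd_later:
  assumes "Suc l < length v"
  shows "ewt_individuals ws (x(v := m)) l = ewt_individuals ws x l"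
proof -
  have "ewt_type ws (x(v := m)) u = ewt_type ws x u" if "length u = Suc l" for u
    using assms that by (intro ewt_type_cong) auto
  then show ?thesis
    by (auto simp: ewt_individuals_def)
qed

text \<open>Isolates the single condition \<open>R v\<close> from all others; it is applied with
  \<open>R\<close> saying that a label is actual, and \<open>v\<close> the label whose mark
  varies.\<close>

lemma Collect_conj_eq_iff_except:
  assumes "T v" "v \<in> S"
  shows "{u. T u \<and> R u} = S \<longleftrightarrow> S \<subseteq> Collect T \<and> (\<forall>u. u \<noteq> v \<and> T u \<longrightarrow> R u = (u \<in> S)) \<and> R v" (is "?L \<longleftrightarrow> ?R")
proof
  show "?L \<Longrightarrow> ?R"
    using assms by force
  show "?R \<Longrightarrow> ?L"
    using assms by (intro set_eqI) (metis mem_Collect_eq subsetD)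
qed

text \<open>Within generation \<open>Suc l\<close>, the mark of \<open>v\<close> decides only
  whether \<open>v\<close> itself is actual. Here \<open>a\<close> is the weight of the parent of
  \<open>v\<close> and \<open>c\<close> collects all conditions on the other marks, so the event has
  the shape treated in \<open>emeasure_actual_retained_ge\<close>.\<close>

lemma ewt_individuals_upd_eq:
  assumes "length v = Suc (Suc l)" "v \<in> S"
  obtains c a where "\<And>m. ewt_individuals ws (x(v := m)) (Suc l) = S \<longleftrightarrow> c \<and> a * snd (snd m) < fst (snd m)"
proof -
  obtain j i u where v: "v = j # i # u"
    using assms(1) by (auto simp: length_Suc_conv)
  let ?c = "\<lambda>x. S \<subseteq> {u. length u = Suc (Suc l)} \<and>
      (\<forall>u'. u' \<noteq> v \<and> length u' = Suc (Suc l) \<longrightarrow> (ewt_type ws x u' \<noteq> None) = (u' \<in> S)) \<and>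
      ewt_type ws x (i # u) \<noteq> None \<and> j < fst (ewt_label_type ws x (i # u))"
  have S: "ewt_individuals ws y (Suc l) = S \<longleftrightarrow>
      ?c y \<and> snd (ewt_label_type ws y (i # u)) * snd (snd (y v)) < fst (snd (y v))" for y
    unfolding ewt_individuals_def Collect_conj_eq_iff_except[where T = "\<lambda>u. length u = Suc (Suc l)", OF assms]
    unfolding v ewt_type_Cons_ne_None by (simp only: conj_assoc)
  \<comment> \<open>Since \<open>v\<close> has length \<open>l + 2\<close>, it is neither
    \<open>u'\<close> nor one of the shorter words on which the type of \<open>u'\<close>
    depends.\<close>
  have type: "ewt_type ws (x(v := m)) u' = ewt_type ws x u'" if "u' \<noteq> v" "length u' \<le> Suc (Suc l)" for u' m
    using assms that by (intro ewt_type_cong) auto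
  have label: "ewt_label_type ws (x(v := m)) (i # u) = ewt_label_type ws x (i # u)" for m
    by (cases u) (auto simp: v)
  have parent: "ewt_type ws (x(v := m)) (i # u) = ewt_type ws x (i # u)" for m
    using assms(1) by (intro type) (auto simp: v)
  have "?c (x(v := m)) = ?c x" for m
    by (simp add: label parent type cong: conj_cong)
  then have "ewt_individuals ws (x(v := m)) (Suc l) = S \<longleftrightarrow>
      ?c x \<and> snd (ewt_label_type ws x (i # u)) * snd (snd m) < fst (snd m)" for m
    using S[of "x(v := m)"] by (simp only: label fun_upd_same)
  then show ?thesis
    by (rule that)
qed

text \<open>Labels in generation \<open>Suc l\<close> have length at least two, so their types come
  from their own marks: each has \<open>K - 1\<close> potential children and weight
  \<open>x \<ge> 1\<close>. For each potential child \<open>z \<le> U \<le> x * U\<close>, so none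
  is actual.\<close>

lemma ewt_individuals_Suc_eq_empty:
  assumes "\<And>v. v \<in> ewt_individuals ws X (Suc l) \<Longrightarrow> X v \<in> {K} \<times> {1..} \<times> UNIV"
    and "\<And>v j. v \<in> ewt_individuals ws X (Suc l) \<Longrightarrow> j < K \<Longrightarrow>
      0 \<le> snd (snd (X (j # v))) \<and> fst (snd (X (j # v))) \<le> snd (snd (X (j # v)))"
  shows "ewt_individuals ws X (Suc (Suc l)) = {}"
proof (rule ccontr)
  assume "ewt_individuals ws X (Suc (Suc l)) \<noteq> {}"
  then obtain w where w: "w \<in> ewt_individuals ws X (Suc (Suc l))"
    by blast
  then have "length w = Suc (Suc (Suc l))"
    by (simp add: ewt_individuals_def)
  then obtain j i i' u where w_eq: "w = j # i # i' # u"
    by (auto simp: length_Suc_conv)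
  let ?v = "i # i' # u"
  have "length w = Suc (Suc (Suc l))" "ewt_type ws X (j # ?v) \<noteq> None"
    using w unfolding ewt_individuals_def w_eq by blast+
  then have v: "?v \<in> ewt_individuals ws X (Suc l)" and j: "j < fst (X ?v) - 1"
    and U: "fst (snd (X ?v)) * snd (snd (X (j # ?v))) < fst (snd (X (j # ?v)))"
    unfolding ewt_type_Cons_ne_None[of ws X j] by (simp_all add: ewt_individuals_def w_eq del: ewt_type.simps)
  have "fst (X ?v) = K \<and> 1 \<le> fst (snd (X ?v))"
    using assms(1)[OF v] unfolding mem_Times_iff by blast
  then have K: "fst (X ?v) = K" "1 \<le> fst (snd (X ?v))"
    by blast+
  have D: "0 \<le> snd (snd (X (j # ?v)))" "fst (snd (X (j # ?v))) \<le> snd (snd (X (j # ?v)))"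
    using assms(2)[OF v, of j] j unfolding K by linarith+
  have "1 * snd (snd (X (j # ?v))) \<le> fst (snd (X ?v)) * snd (snd (X (j # ?v)))"
    using K D by (intro mult_right_mono)
  with U D show False
    by simp
qed

lemma ewt_individuals_empty_mono:
  assumes "ewt_individuals ws X l = {}" "l \<le> l'"
  shows "ewt_individuals ws X l' = {}"
  using assms(2,1) by (induction rule: dec_induct) (auto simp: ewt_individuals_Suc)

lemma size_ewt_generation: "size (ewt_generation ws X l) = card (ewt_individuals ws X l)"
  by (simp add: ewt_generation_def)

section \<open>Uniform lower bound on immediate extinction\<close>

context ewt_marks
begin

abbreviation individuals :: "(nat \<times> real) list \<Rightarrow> nat \<Rightarrow> 'a \<Rightarrow> nat list set" where
  "individuals ws l w \<equiv> ewt_individuals ws (\<lambda>u. X u w) l"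

lemma measurable_individuals_eq [measurable]: "Measurable.pred M (\<lambda>w. individuals ws l w = S)"
  by (rule measurable_compose[OF measurable_marks measurable_ewt_individuals_eq])

text \<open>A generation is a finite set of words, and there are only countably many such sets, so
  any property \<open>Q\<close> of it is a countable union of events.\<close>

lemma measurable_individuals [measurable]: "Measurable.pred M (\<lambda>w. Q (individuals ws l w))"
proof -
  have "countable {S :: nat list set. finite S}"
    by (rule countable_Collect_finite)
  moreover have "Q (individuals ws l w) \<longleftrightarrow> (\<exists>S\<in>{S. finite S}. Q S \<and> individuals ws l w = S)" for w
    using finite_ewt_individuals by blast
  ultimately show ?thesis
    by (simp only:) (intro measurable_pred_countable(2) pred_intros_logic; simp)
qed

text \<open>Fix the value \<open>S\<close> of generation \<open>Suc l\<close>. Forcing the marks of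
  its members into \<open>C\<close> and those of their relevant potential children into
  \<open>D\<close> empties the next generation. Each condition costs at most a factor
  \<open>r\<close>, and at most \<open>k * Suc K\<close> marks are involved, so the bound is uniform
  in \<open>l\<close> and \<open>S\<close>; it is then summed over \<open>S\<close>.\<close>

lemma extinction_ge:
  assumes int: "integrable (measure_pmf P) real"
  obtains d where "0 < d" and
    "\<And>l. d * prob {w \<in> space M. 0 < card (individuals ws (Suc l) w) \<and> card (individuals ws (Suc l) w) \<le> k}
      \<le> prob {w \<in> space M. (0 < card (individuals ws (Suc l) w) \<and> card (individuals ws (Suc l) w) \<le> k) \<and>
          individuals ws (Suc (Suc l)) w = {}}"
proof -
  interpret D: prob_space "mark_distr P"
    by (rule prob_space_mark_distr)
  obtain K where K: "K \<in> set_pmf P"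
    using set_pmf_not_empty[of P] by auto
  define C :: "mark set" where "C = {K} \<times> {1..} \<times> UNIV"
  define D :: "mark set" where "D = {y. 0 \<le> snd (snd y) \<and> fst (snd y) \<le> snd (snd y)}"
  obtain r0 where r0: "0 < r0" and
    retained: "\<And>x. ennreal r0 * emeasure (mark_distr P) {y. x * snd (snd y) < fst (snd y)}
      \<le> emeasure (mark_distr P) {y. x * snd (snd y) < fst (snd y) \<and> y \<in> C}"
    by (rule emeasure_actual_retained_ge[OF int K, folded C_def]) (rule that)
  define r where "r = min (ennreal r0) (emeasure (mark_distr P) D)"
  have r: "0 < r" "r \<le> 1"
    using r0 emeasure_childless_pos D.emeasure_le_1[of D] by (auto simp: r_def D_def min_le_iff_disj)
  have C: "C \<in> sets mark_space"
    unfolding C_def mark_space_def by (intro pair_measureI) auto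
  have "{y \<in> space mark_space. 0 \<le> snd (snd y) \<and> fst (snd y) \<le> snd (snd y)} \<in> sets mark_space"
    by measurable
  then have D: "D \<in> sets mark_space"
    by (simp add: D_def)
  define \<delta> where "\<delta> = r ^ (k * Suc K)"
  have "\<delta> \<noteq> 0"
    using r(1) unfolding \<delta>_def by (intro power_not_zero) (rule less_imp_neq[symmetric])
  then have \<delta>: "0 < \<delta>" "\<delta> \<le> 1"
    unfolding \<delta>_def using r(2) by (simp_all only: zero_less_iff_neq_zero power_le_one zero_le not_False_eq_True)
  have main: "\<delta> * emeasure M {w \<in> space M. individuals ws (Suc l) w = S}
      \<le> emeasure M {w \<in> space M. individuals ws (Suc l) w = S \<and> individuals ws (Suc (Suc l)) w = {}}"
    if S: "finite S" "card S \<le> k" for l S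
  proof (cases "\<forall>v\<in>S. length v = Suc (Suc l)")
    case False
    then have "individuals ws (Suc l) w \<noteq> S" for w
      by (auto simp: ewt_individuals_def)
    then show ?thesis
      by simp
  next
    case True
    \<comment> \<open>A member of \<open>S\<close> whose mark lies in \<open>C\<close> has fewer than \<open>K\<close> potential children.\<close>
    define F where "F = S \<union> (\<lambda>(j, v). j # v) ` ({..<K} \<times> S)"
    have F: "finite F"
      using S by (simp add: F_def)
    have "card F \<le> card S + card ({..<K} \<times> S)"
      unfolding F_def using S by (intro order_trans[OF card_Un_le] add_left_mono card_image_le) auto
    also have "\<dots> = card S * Suc K"
      by (simp add: card_cartesian_product)
    also have "\<dots> \<le> k * Suc K"
      using S by (intro mult_right_mono) auto
    finally have "\<delta> \<le> r ^ card F"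
      unfolding \<delta>_def using r by (intro power_decreasing) auto
    then have "\<delta> * emeasure M {w \<in> space M. individuals ws (Suc l) w = S}
        \<le> r ^ card F * emeasure M {w \<in> space M. individuals ws (Suc l) w = S}"
      by (intro mult_right_mono) auto
    also have "\<dots> \<le> emeasure M {w \<in> space M. individuals ws (Suc l) w = S \<and>
        (\<forall>v\<in>F. X v w \<in> (if length v = Suc (Suc l) then C else D))}"
    proof (rule emeasure_resample_finite[OF F measurable_ewt_individuals_eq])
      show "(if length v = Suc (Suc l) then C else D) \<in> sets mark_space" for v :: "nat list"
        using C D by simp
    next
      fix v x
      assume v: "v \<in> F"
      let ?C = "if length v = Suc (Suc l) then C else D"
      show "r * emeasure (mark_distr P) {m. ewt_individuals ws (x(v := m)) (Suc l) = S}
          \<le> emeasure (mark_distr P) {m. ewt_individuals ws (x(v := m)) (Suc l) = S \<and> m \<in> ?C}"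
      \<comment> \<open>A member of \<open>S\<close> must remain actual, so its condition is weighed
        against the actual marks only. A potential child of a member is too long a word to affect
        generation \<open>Suc l\<close>, so its condition keeps the full probability of
        \<open>D\<close>.\<close>
      proof (cases "v \<in> S")
        case v': True
        then have len: "length v = Suc (Suc l)"
          using True by simp
        obtain c a where ca: "\<And>m. ewt_individuals ws (x(v := m)) (Suc l) = S \<longleftrightarrow>
            c \<and> a * snd (snd m) < fst (snd m)"
          by (rule ewt_individuals_upd_eq[OF len v']) (rule that)
        have "r * emeasure (mark_distr P) {m. a * snd (snd m) < fst (snd m)}
            \<le> ennreal r0 * emeasure (mark_distr P) {m. a * snd (snd m) < fst (snd m)}"
          by (intro mult_right_mono) (auto simp: r_def)
        also note retained[of a]
        finally show ?thesis
          unfolding ca using len by (cases c) simp_all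
      next
        case False
        then have len: "length v = Suc (Suc (Suc l))"
          using v True by (auto simp: F_def)
        have "r * emeasure (mark_distr P) UNIV \<le> emeasure (mark_distr P) D"
          using D.emeasure_space_1 by (simp add: r_def)
        then show ?thesis
          using len by (cases "ewt_individuals ws x (Suc l) = S") (simp_all add: ewt_individuals_upd_later)
      qed
    qed
    also have "\<dots> \<le> emeasure M {w \<in> space M. individuals ws (Suc l) w = S \<and> individuals ws (Suc (Suc l)) w = {}}"
    proof (rule emeasure_mono)
      have "individuals ws (Suc (Suc l)) w = {}"
        if w: "individuals ws (Suc l) w = S" "\<forall>v\<in>F. X v w \<in> (if length v = Suc (Suc l) then C else D)" for w
      proof (rule ewt_individuals_Suc_eq_empty)
        fix v
        assume v: "v \<in> individuals ws (Suc l) w"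
        then have "v \<in> F" "length v = Suc (Suc l)"
          using True w(1) by (auto simp: F_def)
        then show "X v w \<in> {K} \<times> {1..} \<times> UNIV"
          using w(2) by (auto simp: C_def)
        fix j
        assume "j < K"
        then have "j # v \<in> F"
          using v w(1) by (auto simp: F_def)
        then have "X (j # v) w \<in> D"
          using w(2) \<open>length v = Suc (Suc l)\<close> by fastforce
        then show "0 \<le> snd (snd (X (j # v) w)) \<and> fst (snd (X (j # v) w)) \<le> snd (snd (X (j # v) w))"
          by (simp add: D_def)
      qed
      then show "{w \<in> space M. individuals ws (Suc l) w = S \<and>
            (\<forall>v\<in>F. X v w \<in> (if length v = Suc (Suc l) then C else D))}
          \<subseteq> {w \<in> space M. individuals ws (Suc l) w = S \<and> individuals ws (Suc (Suc l)) w = {}}"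
        by blast
      show "{w \<in> space M. individuals ws (Suc l) w = S \<and> individuals ws (Suc (Suc l)) w = {}} \<in> events"
        by measurable
    qed
    finally show ?thesis .
  qed
  define SS :: "nat list set set" where "SS = {S. finite S \<and> 0 < card S \<and> card S \<le> k}"
  have "countable SS"
    by (rule countable_subset[OF _ countable_Collect_finite]) (auto simp: SS_def)
  have split: "emeasure M {w \<in> space M. (0 < card (individuals ws (Suc l) w) \<and> card (individuals ws (Suc l) w) \<le> k) \<and> Q w} =
      (\<integral>\<^sup>+S. emeasure M {w \<in> space M. individuals ws (Suc l) w = S \<and> Q w} \<partial>count_space SS)"
    if [measurable]: "Measurable.pred M Q" for l Q
  proof -
    have "{w \<in> space M. (0 < card (individuals ws (Suc l) w) \<and> card (individuals ws (Suc l) w) \<le> k) \<and> Q w} =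
        (\<Union>S\<in>SS. {w \<in> space M. individuals ws (Suc l) w = S \<and> Q w})"
      by (auto simp: SS_def finite_ewt_individuals)
    then show ?thesis
      using \<open>countable SS\<close> by (simp only:) (rule emeasure_UN_countable; auto simp: disjoint_family_on_def)
  qed
  have le: "\<delta> * emeasure M {w \<in> space M. 0 < card (individuals ws (Suc l) w) \<and> card (individuals ws (Suc l) w) \<le> k}
      \<le> emeasure M {w \<in> space M. (0 < card (individuals ws (Suc l) w) \<and> card (individuals ws (Suc l) w) \<le> k) \<and>
          individuals ws (Suc (Suc l)) w = {}}" for l
  proof -
    have "\<delta> * emeasure M {w \<in> space M. 0 < card (individuals ws (Suc l) w) \<and> card (individuals ws (Suc l) w) \<le> k} =
        (\<integral>\<^sup>+S. \<delta> * emeasure M {w \<in> space M. individuals ws (Suc l) w = S} \<partial>count_space SS)"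
      using split[of "\<lambda>_. True" l] by (simp add: nn_integral_cmult)
    also have "\<dots> \<le> (\<integral>\<^sup>+S. emeasure M {w \<in> space M. individuals ws (Suc l) w = S \<and>
        individuals ws (Suc (Suc l)) w = {}} \<partial>count_space SS)"
      by (intro nn_integral_mono main) (auto simp: SS_def)
    also have "\<dots> = emeasure M {w \<in> space M. (0 < card (individuals ws (Suc l) w) \<and>
        card (individuals ws (Suc l) w) \<le> k) \<and> individuals ws (Suc (Suc l)) w = {}}"
      by (rule split[symmetric]) measurable
    finally show ?thesis .
  qed
  \<comment> \<open>The bound \<open>\<delta> \<le> 1\<close> makes \<open>\<delta>\<close> finite,
    so it comes from a real number.\<close>
  obtain d where d: "\<delta> = ennreal d" "0 \<le> d"
    using \<delta> by (cases \<delta>) (auto simp: top_unique)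
  show ?thesis
  proof
    show "0 < d"
      using \<delta> d by simp
    show "d * prob {w \<in> space M. 0 < card (individuals ws (Suc l) w) \<and> card (individuals ws (Suc l) w) \<le> k}
      \<le> prob {w \<in> space M. (0 < card (individuals ws (Suc l) w) \<and> card (individuals ws (Suc l) w) \<le> k) \<and>
          individuals ws (Suc (Suc l)) w = {}}" for l
      using le[of l] d by (simp add: emeasure_eq_measure ennreal_mult[symmetric])
  qed
qed

end

section \<open>Summability and the Borel-Cantelli lemma\<close>

theorem lemma5p23:
  fixes P :: "nat pmf"
    and M :: "'a measure"
    and \<omega> :: "(nat \<times> real) multiset"
    and Z :: "nat \<Rightarrow> 'a \<Rightarrow> (nat \<times> real) multiset"
    and k :: nat
  assumes "0 \<notin> set_pmf P"
    and "integrable (measure_pmf P) real"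
    and "pmf P 1 < 1"
    and "set_mset \<omega> \<subseteq> Omega"
    and "ewt_branching_process M P \<omega> Z"
    and "k \<ge> 1"
  shows "{w \<in> space M. infinite {l. 0 < size (Z l w) \<and> size (Z l w) \<le> k}} \<in> sets M \<and>
         measure M {w \<in> space M. infinite {l. 0 < size (Z l w) \<and> size (Z l w) \<le> k}} = 0"
proof -
  obtain ws X where "prob_space M" "prob_space.indep_vars M (\<lambda>_. mark_space) X UNIV"
    "\<And>u. distributed M mark_space (X u) (\<lambda>y. ennreal (mark_density P y))"
    and Z: "\<And>l w. w \<in> space M \<Longrightarrow> Z l w = ewt_generation ws (\<lambda>u. X u w) l"
    using assms(5) unfolding ewt_branching_process_def by blast
  then interpret ewt_marks M P X
    unfolding ewt_marks_def ewt_marks_axioms_def by blast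
  define A where "A l = {w \<in> space M. 0 < card (individuals ws l w) \<and> card (individuals ws l w) \<le> k}" for l
  define B where "B l = {w \<in> space M. (0 < card (individuals ws (Suc l) w) \<and> card (individuals ws (Suc l) w) \<le> k) \<and>
      individuals ws (Suc (Suc l)) w = {}}" for l
  have A [measurable]: "A l \<in> events" for l
    unfolding A_def by measurable
  have B: "B l \<in> events" for l
    unfolding B_def by measurable
  \<comment> \<open>Extinction is permanent: on \<open>B l\<close> generation \<open>l + 2\<close>
    is empty, hence so is generation \<open>l' + 1 \<ge> l + 2\<close>, which is nonempty on
    \<open>B l'\<close>.\<close>
  have "B l \<inter> B l' = {}" if "l < l'" for l l'
    using ewt_individuals_empty_mono[of ws _ "Suc (Suc l)" "Suc l'"] that by (fastforce simp: B_def)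
  then have disj: "disjoint_family B"
    unfolding disjoint_family_on_def by (metis Int_commute nat_neq_iff)
  obtain d where d: "0 < d" "\<And>l. d * prob (A (Suc l)) \<le> prob (B l)"
    unfolding A_def B_def by (rule extinction_ge[OF assms(2), of ws k]) (rule that[unfolded A_def B_def])
  have "summable (\<lambda>l. prob (B l))"
    using finite_measure_UNION[of B] B disj by (auto simp: sums_iff)
  moreover have "norm (d * prob (A (Suc l))) \<le> prob (B l)" for l
    using d(1) d(2)[of l] by (simp add: abs_mult)
  ultimately have "summable (\<lambda>l. d * prob (A (Suc l)))"
    by (rule summable_comparison_test'[where N = 0])
  \<comment> \<open>The estimate starts with generation \<open>1\<close>, since the initial types
    are prescribed and not drawn from marks. The one missing term does not affect
    summability.\<close>
  then have "summable (\<lambda>l. prob (A l))"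
    using d(1) summable_Suc_iff[of "\<lambda>l. prob (A l)"] by (simp add: summable_cmult_iff)
  then have "limsup A \<in> null_sets M"
    by (intro borel_cantelli_limsup1) (auto simp: emeasure_eq_measure)
  moreover have "limsup A = {w \<in> space M. infinite {l. 0 < size (Z l w) \<and> size (Z l w) \<le> k}}"
  proof -
    have "w \<in> limsup A \<longleftrightarrow> infinite {l. w \<in> A l}" for w
      by (auto simp: limsup_INF_SUP infinite_nat_iff_unbounded_le)
    moreover have "{l. w \<in> A l} = (if w \<in> space M then {l. 0 < size (Z l w) \<and> size (Z l w) \<le> k} else {})" for w
      by (auto simp: A_def Z size_ewt_generation)
    ultimately show ?thesis
      by (auto split: if_splits)
  qed
  ultimately show ?thesis
    by (simp add: null_sets_def measure_def)
qed

end
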